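(* Let $G$ be a nut graph. Then $o_e(G) \geq o_v(G) + 1$.
   Context: All graphs are finite, simple and connected. For a graph $G$ with adjacency matrix $\mathbf{A}(G)$, the nullity $\eta(G)$ is the dimension of $\ker \mathbf{A}(G)$. A nut graph is a graph $G$ with $\eta(G) = 1$ such that a non-zero vector $\mathbf{x}$ spanning $\ker\mathbf{A}(G)$ has no zero entry. By convention the isolated vertex $K_1$ is regarded as a trivial case and is not considered a nut graph (non-trivial nut graphs have at least $7$ vertices). $\mathrm{Aut}(G)$ denotes the full automorphism group of $G$; $o_v(G)$ is the number of orbits of $\mathrm{Aut}(G)$ on $V(G)$ and $o_e(G)$ is the number of orbits of $\mathrm{Aut}(G)$ on $E(G)$ (where $\alpha$ maps edge $\{u,v\}$ to $\{u^\alpha,v^\alpha\}$). *)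

theory Defs
  imports "HOL-Analysis.Analysis" "HOL-Algebra.Group_Action"
begin

text \<open>A graph has the finite type \<open>'v\<close> as its vertex set and is given by its set of edges,
  which are unordered pairs of distinct vertices.\<close>

definition simple_graph :: "'v::finite set set \<Rightarrow> bool" where
  "simple_graph E \<longleftrightarrow> (\<forall>e\<in>E. card e = 2)"

definition connected_graph :: "'v::finite set set \<Rightarrow> bool" where
  "connected_graph E \<longleftrightarrow> (\<forall>u v. (u, v) \<in> {(a, b). {a, b} \<in> E}\<^sup>*)"

definition adj_matrix :: "'v::finite set set \<Rightarrow> real ^ 'v ^ 'v" where
  "adj_matrix E = (\<chi> u v. if {u, v} \<in> E then 1 else 0)"

definition adj_kernel :: "'v::finite set set \<Rightarrow> (real ^ 'v) set" where
  "adj_kernel E = {x. adj_matrix E *v x = 0}"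

definition nullity :: "'v::finite set set \<Rightarrow> nat" where
  "nullity E = dim (adj_kernel E)"

text \<open>The condition on \<open>CARD('v)\<close> excludes the isolated vertex, which by convention
  is not a nut graph.\<close>

definition nut_graph :: "'v::finite set set \<Rightarrow> bool" where
  "nut_graph E \<longleftrightarrow>
     simple_graph E \<and> connected_graph E \<and> CARD('v) > 1 \<and> nullity E = 1 \<and>
     (\<exists>x. x \<noteq> 0 \<and> span {x} = adj_kernel E \<and> (\<forall>v. x $ v \<noteq> 0))"

definition aut_group :: "'v::finite set set \<Rightarrow> ('v \<Rightarrow> 'v) monoid" where
  "aut_group E = (BijGroup UNIV)
     \<lparr>carrier := {\<pi>. bij \<pi> \<and> (\<forall>u v. {\<pi> u, \<pi> v} \<in> E \<longleftrightarrow> {u, v} \<in> E)}\<rparr>"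

text \<open>The restriction to \<open>E\<close> is only there because group actions in the library are
  by extensional functions on the carrier.\<close>

definition edge_action :: "'v::finite set set \<Rightarrow> ('v \<Rightarrow> 'v) \<Rightarrow> 'v set \<Rightarrow> 'v set" where
  "edge_action E \<pi> = (\<lambda>e\<in>E. \<pi> ` e)"

definition num_vertex_orbits :: "'v::finite set set \<Rightarrow> nat" where
  "num_vertex_orbits E = card (orbits (aut_group E) UNIV (\<lambda>\<pi>. \<pi>))"

definition num_edge_orbits :: "'v::finite set set \<Rightarrow> nat" where
  "num_edge_orbits E = card (orbits (aut_group E) E (edge_action E))"

lemma subgroup_aut_group:
  "subgroup (carrier (aut_group E)) (BijGroup (UNIV :: 'v::finite set))"
proof (rule group.subgroupI[OF group_BijGroup])
  fix \<pi> assume a: "\<pi> \<in> carrier (aut_group E)"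
  then have b: "bij \<pi>" by (simp add: aut_group_def)
  then have B: "\<pi> \<in> Bij UNIV" by (simp add: Bij_def)
  have i: "inv\<^bsub>BijGroup UNIV\<^esub> \<pi> = inv_into UNIV \<pi>"
    using inv_BijGroup[OF B] by (simp add: restrict_def)
  have "{inv_into UNIV \<pi> u, inv_into UNIV \<pi> v} \<in> E \<longleftrightarrow> {u, v} \<in> E" for u v
  proof -
    have "{\<pi> (inv_into UNIV \<pi> u), \<pi> (inv_into UNIV \<pi> v)} \<in> E
        \<longleftrightarrow> {inv_into UNIV \<pi> u, inv_into UNIV \<pi> v} \<in> E"
      using a by (simp add: aut_group_def)
    then show ?thesis using b by (simp add: bij_is_surj surj_f_inv_f)
  qed
  then show "inv\<^bsub>BijGroup UNIV\<^esub> \<pi> \<in> carrier (aut_group E)"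
    unfolding i using b by (simp add: aut_group_def bij_imp_bij_inv)
next
  show "carrier (aut_group E) \<subseteq> carrier (BijGroup UNIV)"
    by (auto simp: aut_group_def BijGroup_def Bij_def)
  have "id \<in> carrier (aut_group E)" by (simp add: aut_group_def)
  then show "carrier (aut_group E) \<noteq> {}" by blast
next
  fix \<pi> \<sigma> assume a: "\<pi> \<in> carrier (aut_group E)" "\<sigma> \<in> carrier (aut_group E)"
  then have "\<pi> \<otimes>\<^bsub>BijGroup UNIV\<^esub> \<sigma> = \<pi> \<circ> \<sigma>"
    by (auto simp: aut_group_def BijGroup_def Bij_def compose_def)
  then show "\<pi> \<otimes>\<^bsub>BijGroup UNIV\<^esub> \<sigma> \<in> carrier (aut_group E)"
    using a by (simp add: aut_group_def bij_comp)
qed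

lemma group_aut_group: "group (aut_group E)"
  using group.subgroup_imp_group[OF group_BijGroup subgroup_aut_group[of E]]
  by (simp add: aut_group_def)

lemma group_action_vertices: "group_action (aut_group E) UNIV (\<lambda>\<pi>. \<pi>)"
proof -
  have "(\<lambda>\<pi>. \<pi>) \<in> hom (aut_group E) (BijGroup UNIV)"
    by (auto simp: hom_def aut_group_def BijGroup_def Bij_def)
  then show ?thesis
    unfolding group_action_def group_hom_def group_hom_axioms_def
    using group_aut_group group_BijGroup by blast
qed

lemma group_action_edges:
  assumes "simple_graph E"
  shows "group_action (aut_group E) E (edge_action E)"
proof -
  have mem: "\<pi> ` e \<in> E \<longleftrightarrow> e \<in> E" if "\<pi> \<in> carrier (aut_group E)" for \<pi> e
  proof -
    have p: "bij \<pi>" "\<And>u v. {\<pi> u, \<pi> v} \<in> E \<longleftrightarrow> {u, v} \<in> E"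
      using that by (auto simp: aut_group_def)
    have c: "card (\<pi> ` e) = card e"
      using p(1) by (meson bij_is_inj card_image inj_on_subset subset_UNIV)
    show ?thesis
    proof (cases "card e = 2")
      case True
      then obtain u v where "e = {u, v}" by (meson card_2_iff)
      then show ?thesis using p(2) by simp
    qed (use assms c in \<open>auto simp: simple_graph_def\<close>)
  qed
  have bij: "edge_action E \<pi> \<in> Bij E" if "\<pi> \<in> carrier (aut_group E)" for \<pi>
  proof -
    have b: "bij \<pi>" using that by (simp add: aut_group_def)
    have "inj_on (image \<pi>) E"
      using b by (meson bij_is_inj inj_image_eq_iff inj_onI)
    moreover have "image \<pi> ` E \<subseteq> E" using mem[OF that] by auto
    ultimately have "bij_betw (image \<pi>) E E"
      by (simp add: bij_betw_def endo_inj_surj)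
    then show ?thesis
      unfolding Bij_def edge_action_def by (auto cong: bij_betw_cong)
  qed
  have "edge_action E \<in> hom (aut_group E) (BijGroup E)"
  proof (rule homI)
    fix \<pi> \<sigma> assume a: "\<pi> \<in> carrier (aut_group E)" "\<sigma> \<in> carrier (aut_group E)"
    have "\<pi> \<otimes>\<^bsub>aut_group E\<^esub> \<sigma> = \<pi> \<circ> \<sigma>"
      using a by (auto simp: aut_group_def BijGroup_def Bij_def compose_def)
    then show "edge_action E (\<pi> \<otimes>\<^bsub>aut_group E\<^esub> \<sigma>) =
        edge_action E \<pi> \<otimes>\<^bsub>BijGroup E\<^esub> edge_action E \<sigma>"
      using bij[OF a(1)] bij[OF a(2)] mem[OF a(2)]
      by (auto simp: BijGroup_def compose_def edge_action_def restrict_def image_image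
            intro!: ext)
  qed (use bij in \<open>auto simp: BijGroup_def\<close>)
  then show ?thesis
    unfolding group_action_def group_hom_def group_hom_axioms_def
    using group_aut_group group_BijGroup by blast
qed

end

theory Submission
  imports Defs
begin

text \<open>
  Let \<open>x\<close> span the kernel. The incidence map \<open>L\<close>, \<open>(L y)(uv) = y(u) + y(v)\<close>, is injective: if
  \<open>L y = 0\<close>, then the pointwise product \<open>x y\<close> lies in the kernel as well, so \<open>y\<close> is
  constant and hence zero. Every automorphism maps \<open>x\<close> to \<open>x\<close> or \<open>- x\<close>, so the edge function
  \<open>q(uv) = x(u) x(v)\<close> is invariant; it is orthogonal to the image of \<open>L\<close> because
  \<open>x\<close> is in the kernel. Thus \<open>q\<close> together with the image under \<open>L\<close> of the
  invariant vertex functions spans a space of dimension \<open>o\<^sub>v + 1\<close> inside the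
  invariant edge functions, which have dimension \<open>o\<^sub>e\<close>.
\<close>

section \<open>Indicator vectors of disjoint blocks\<close>

definition indicator_vec :: "'a::finite set \<Rightarrow> real ^ 'a" where
  "indicator_vec A = (\<chi> a. indicator A a)"

lemma inj_indicator_vec: "inj indicator_vec"
proof (rule injI)
  fix A B :: "'a set" assume "indicator_vec A = indicator_vec B"
  then have "indicator A a = (indicator B a :: real)" for a
    by (simp add: indicator_vec_def vec_eq_iff)
  then show "A = B" by (metis indicator_eq_1_iff subsetI subset_antisym)
qed

text \<open>Disjoint supports make the vectors orthogonal, and non-empty blocks make them
  non-zero.\<close>

lemma independent_indicator_vec:
  assumes "pairwise disjnt C" "{} \<notin> C"
  shows "independent (indicator_vec ` C)"
proof (rule pairwise_orthogonal_independent)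
  have "orthogonal (indicator_vec A) (indicator_vec B)" if "disjnt A B" for A B :: "'a set"
    using that by (auto simp: orthogonal_def inner_vec_def indicator_vec_def indicator_def disjnt_iff)
  then show "pairwise orthogonal (indicator_vec ` C)"
    using assms(1) by (intro pairwise_imageI) (auto dest: pairwiseD)
  show "0 \<notin> indicator_vec ` C"
    using assms(2) by (auto simp: indicator_vec_def vec_eq_iff indicator_def split: if_splits)
qed

lemma constant_on_blocks_in_span:
  fixes f :: "real ^ 'a::finite"
  assumes "pairwise disjnt C"
    and const: "\<And>A a b. A \<in> C \<Longrightarrow> a \<in> A \<Longrightarrow> b \<in> A \<Longrightarrow> f $ a = f $ b"
    and zero: "\<And>a. a \<notin> \<Union> C \<Longrightarrow> f $ a = 0"
  shows "f \<in> span (indicator_vec ` C)"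
proof -
  \<comment> \<open>The choice of representative is immaterial, since \<open>f\<close> is constant
    on each block; for an empty block \<open>r\<close> is arbitrary but multiplies the zero
    vector.\<close>
  define r where "r A = f $ (SOME a. a \<in> A)" for A
  have "f = (\<Sum>A\<in>C. r A *\<^sub>R indicator_vec A)"
  proof (rule vec_eq_iff[THEN iffD2], rule allI)
    fix a
    have "(\<Sum>A\<in>C. r A * indicator A a) = f $ a"
    proof (cases "a \<in> \<Union> C")
      case True
      then obtain B where B: "B \<in> C" "a \<in> B" by blast
      have "(SOME b. b \<in> B) \<in> B" using B(2) by (rule someI)
      then have r: "r B = f $ a" using const B unfolding r_def by blast
      have "(\<Sum>A\<in>C. r A * indicator A a) = (\<Sum>A\<in>C. if A = B then r B else 0)"
        using B assms(1) by (intro sum.cong) (auto simp: pairwise_def disjnt_iff indicator_def)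
      then show ?thesis using B r by simp
    next
      case False
      then have "(\<Sum>A\<in>C. r A * indicator A a) = 0"
        by (intro sum.neutral) (auto simp: indicator_def)
      then show ?thesis using zero[OF False] by simp
    qed
    then show "f $ a = (\<Sum>A\<in>C. r A *\<^sub>R indicator_vec A) $ a"
      by (simp add: indicator_vec_def)
  qed
  then show ?thesis by (simp add: span_base span_scale span_sum)
qed

lemma (in group_action) pairwise_disjnt_orbits: "pairwise disjnt (orbits G E \<phi>)"
  using disjoint_union by (auto simp: pairwise_def disjnt_def)

lemma (in group_action) empty_notin_orbits: "{} \<notin> orbits G E \<phi>"
  using orbit_refl unfolding orbits_def by blast

section \<open>Adjacency sums and edge functions\<close>

lemma aut_group_iff:
  "\<pi> \<in> carrier (aut_group E) \<longleftrightarrow> bij \<pi> \<and> (\<forall>u v. {\<pi> u, \<pi> v} \<in> E \<longleftrightarrow> {u, v} \<in> E)"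
  by (simp add: aut_group_def)

lemma adj_matrix_mult: "(adj_matrix E *v x) $ v = (\<Sum>w | {v, w} \<in> E. x $ w)"
  by (simp add: adj_matrix_def matrix_vector_mult_def if_distrib if_distribR sum.If_cases
      flip: sum.inter_filter cong: if_cong)

lemma simple_graph_edgeE:
  assumes "simple_graph E" "e \<in> E"
  obtains u v where "e = {u, v}" "u \<noteq> v"
  using assms unfolding simple_graph_def by (metis card_2_iff)

text \<open>In a simple graph the edges at \<open>v\<close> correspond bijectively to its
  neighbours.\<close>

lemma sum_incident_edges:
  assumes "simple_graph E"
  shows "(\<Sum>e | e \<in> E \<and> v \<in> e. f e) = (\<Sum>w | {v, w} \<in> E. f {v, w})"
proof -
  have "inj_on (\<lambda>w. {v, w}) {w. {v, w} \<in> E}"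
    by (auto simp: inj_on_def doubleton_eq_iff)
  moreover have "{e. e \<in> E \<and> v \<in> e} = (\<lambda>w. {v, w}) ` {w. {v, w} \<in> E}"
    using simple_graph_edgeE[OF assms] by (auto simp: image_iff) (metis insertE insert_commute singletonD)
  ultimately show ?thesis by (simp add: sum.reindex)
qed

text \<open>The transpose of the unsigned incidence matrix. As vectors are indexed by a whole type,
  edge functions live on all vertex sets and vanish off \<open>E\<close>.\<close>

definition edge_sum :: "'v::finite set set \<Rightarrow> real ^ 'v \<Rightarrow> real ^ ('v set)" where
  "edge_sum E y = (\<chi> e. if e \<in> E then \<Sum>v\<in>e. y $ v else 0)"

definition edge_prod :: "'v::finite set set \<Rightarrow> real ^ 'v \<Rightarrow> real ^ ('v set)" where
  "edge_prod E x = (\<chi> e. if e \<in> E then \<Prod>v\<in>e. x $ v else 0)"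

lemma linear_edge_sum: "linear (edge_sum E)"
  by (rule linearI)
    (auto simp: edge_sum_def vec_eq_iff sum.distrib sum_distrib_left)

text \<open>Regrouping the inner product by vertices instead of edges, the term at \<open>v\<close>
  is x(v) y(v) (A x)(v), and A x = 0.\<close>

lemma edge_prod_orthogonal_edge_sum:
  assumes "simple_graph E" "x \<in> adj_kernel E"
  shows "orthogonal (edge_prod E x) (edge_sum E y)"
proof -
  have "edge_prod E x \<bullet> edge_sum E y = (\<Sum>e\<in>E. \<Sum>v\<in>e. (\<Prod>w\<in>e. x $ w) * y $ v)"
    by (simp add: inner_vec_def edge_prod_def edge_sum_def sum_distrib_left if_distrib if_distribR
        sum.If_cases cong: if_cong)
  also have "\<dots> = (\<Sum>v\<in>UNIV. \<Sum>e | e \<in> E \<and> v \<in> e. (\<Prod>w\<in>e. x $ w) * y $ v)"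
    using sum.swap_restrict[of E UNIV "\<lambda>e v. (\<Prod>w\<in>e. x $ w) * y $ v" "\<lambda>e v. v \<in> e"] by simp
  also have "\<dots> = (\<Sum>v\<in>UNIV. x $ v * y $ v * (\<Sum>w | {v, w} \<in> E. x $ w))"
  proof (rule sum.cong[OF refl])
    fix v
    have "(\<Prod>a\<in>{v, w}. x $ a) = x $ v * x $ w" if "{v, w} \<in> E" for w
      using that assms(1) by (cases "v = w") (auto simp: simple_graph_def)
    then show "(\<Sum>e | e \<in> E \<and> v \<in> e. (\<Prod>w\<in>e. x $ w) * y $ v) =
        x $ v * y $ v * (\<Sum>w | {v, w} \<in> E. x $ w)"
      unfolding sum_incident_edges[OF assms(1)] sum_distrib_left
      by (intro sum.cong) auto
  qed
  also have "\<dots> = 0"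
    using assms(2) by (simp add: adj_kernel_def flip: adj_matrix_mult)
  finally show ?thesis by (simp add: orthogonal_def)
qed

section \<open>Automorphisms, orbits and the kernel\<close>

lemma same_edge_orbitE:
  assumes "simple_graph E" "O' \<in> orbits (aut_group E) E (edge_action E)" "e \<in> O'" "e' \<in> O'"
  obtains \<pi> where "\<pi> \<in> carrier (aut_group E)" "e \<in> E" "e' = \<pi> ` e" "e' \<in> E"
proof -
  interpret group_action "aut_group E" E "edge_action E"
    by (rule group_action_edges[OF assms(1)])
  have E: "e \<in> E" "e' \<in> E" using assms(2-4) orbits_coverture by blast+
  obtain a where a: "a \<in> E" "O' = orbit (aut_group E) (edge_action E) a"
    using assms(2) by (auto simp: orbits_def)
  then have "e' \<in> orbit (aut_group E) (edge_action E) e"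
    using E assms(3,4) orbit_sym orbit_trans by blast
  then show ?thesis using that E by (auto simp: orbit_def edge_action_def)
qed

text \<open>Two edges of one orbit differ by an automorphism, so invariance amounts to being
  constant on orbits. This is how the number of edge orbits bounds the dimension.\<close>

lemma invariant_in_span_edge_orbits:
  assumes "simple_graph E"
    and inv: "\<And>\<pi> e. \<pi> \<in> carrier (aut_group E) \<Longrightarrow> e \<in> E \<Longrightarrow> \<pi> ` e \<in> E \<Longrightarrow> f $ (\<pi> ` e) = f $ e"
    and zero: "\<And>e. e \<notin> E \<Longrightarrow> f $ e = 0"
  shows "f \<in> span (indicator_vec ` orbits (aut_group E) E (edge_action E))"
proof -
  interpret group_action "aut_group E" E "edge_action E"
    by (rule group_action_edges[OF assms(1)])
  show ?thesis
    using pairwise_disjnt_orbits same_edge_orbitE[OF assms(1)] inv zero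
    by (intro constant_on_blocks_in_span) (auto simp: orbits_coverture, metis)
qed

lemma indicator_vec_vertex_orbit_invariant:
  assumes "B \<in> orbits (aut_group E) UNIV (\<lambda>\<pi>. \<pi>)" "\<pi> \<in> carrier (aut_group E)"
  shows "indicator_vec B $ \<pi> v = indicator_vec B $ v"
proof -
  interpret group_action "aut_group E" UNIV "\<lambda>\<pi>. \<pi>"
    by (rule group_action_vertices)
  have "\<pi> v \<in> orbit (aut_group E) (\<lambda>\<pi>. \<pi>) v"
    using assms(2) by (auto simp: orbit_def)
  then have "\<pi> v \<in> B \<longleftrightarrow> v \<in> B"
    using assms(1) orbit_sym orbit_trans unfolding orbits_def by blast
  then show ?thesis by (simp add: indicator_vec_def indicator_def)
qed

text \<open>An automorphism carries the neighbours of \<open>v\<close> bijectively to those of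
  \<open>\<pi> v\<close>, so relabelling commutes with the adjacency matrix.\<close>

lemma adj_kernel_automorphism:
  assumes "\<pi> \<in> carrier (aut_group E)" "x \<in> adj_kernel E"
  shows "(\<chi> v. x $ \<pi> v) \<in> adj_kernel E"
proof -
  have b: "bij \<pi>" and E: "\<And>u v. {\<pi> u, \<pi> v} \<in> E \<longleftrightarrow> {u, v} \<in> E"
    using assms(1) by (auto simp: aut_group_iff)
  have "(adj_matrix E *v (\<chi> v. x $ \<pi> v)) $ v = (adj_matrix E *v x) $ \<pi> v" for v
  proof -
    have "{w. {\<pi> v, w} \<in> E} = \<pi> ` {w. {v, w} \<in> E}"
      using E b by (auto simp: image_iff) (metis bij_pointE)
    moreover have "inj_on \<pi> {w. {v, w} \<in> E}"
      using b by (meson bij_is_inj inj_on_subset subset_UNIV)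
    ultimately show ?thesis by (simp add: adj_matrix_mult sum.reindex)
  qed
  then show ?thesis using assms(2) by (simp add: adj_kernel_def vec_eq_iff)
qed

text \<open>The kernel is a line, so relabelling scales \<open>x\<close> by some \<open>c\<close>;
  it permutes coordinates, so it preserves the norm.\<close>

lemma kernel_vector_automorphism:
  assumes "span {x} = adj_kernel E" "x \<noteq> 0" "\<pi> \<in> carrier (aut_group E)"
  obtains c where "c\<^sup>2 = 1" "\<And>v. x $ \<pi> v = c * x $ v"
proof -
  have "(\<chi> v. x $ \<pi> v) \<in> span {x}"
    using adj_kernel_automorphism[OF assms(3)] assms(1) span_base by blast
  then obtain c where "(\<chi> v. x $ \<pi> v) = c *\<^sub>R x"
    by (auto simp: span_singleton)
  then have c: "x $ \<pi> v = c * x $ v" for v by (simp add: vec_eq_iff)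
  have "bij \<pi>" using assms(3) by (simp add: aut_group_iff)
  then have "(\<Sum>v\<in>UNIV. (x $ v)\<^sup>2) = (\<Sum>v\<in>UNIV. (x $ \<pi> v)\<^sup>2)"
    by (rule sum.reindex_bij_betw[symmetric])
  also have "\<dots> = c\<^sup>2 * (\<Sum>v\<in>UNIV. (x $ v)\<^sup>2)"
    by (simp add: c power_mult_distrib sum_distrib_left)
  finally have "x \<bullet> x = c\<^sup>2 * (x \<bullet> x)"
    by (simp add: inner_vec_def power2_eq_square)
  then have "c\<^sup>2 = 1" using assms(2) by simp
  then show ?thesis using c that by blast
qed

section \<open>Injectivity of the incidence map\<close>

lemma nut_graph_edge:
  fixes E :: "'v::finite set set"
  assumes "nut_graph E"
  obtains e where "e \<in> E"
proof -
  have "\<exists>u v :: 'v. u \<noteq> v"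
    using assms card_le_Suc0_iff_eq[of "UNIV :: 'v set"] by (auto simp: nut_graph_def)
  then obtain u v :: 'v where "u \<noteq> v" by blast
  moreover have "(u, v) \<in> {(a, b). {a, b} \<in> E}\<^sup>*"
    using assms by (simp add: nut_graph_def connected_graph_def)
  \<comment> \<open>A path between distinct vertices starts with an edge.\<close>
  ultimately show ?thesis using that by (auto elim: converse_rtranclE)
qed

text \<open>On an edge \<open>uv\<close>, \<open>edge_sum E y = 0\<close> gives \<open>y(v) = - y(u)\<close>; hence
  \<open>A(x y)(u) = - y(u) (A x)(u) = 0\<close>.\<close>

lemma inj_edge_sum:
  fixes E :: "'v::finite set set"
  assumes "nut_graph E"
  shows "inj (edge_sum E)"
proof -
  have s: "simple_graph E" using assms by (simp add: nut_graph_def)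
  obtain x where x: "span {x} = adj_kernel E" "\<And>v. x $ v \<noteq> 0"
    using assms by (auto simp: nut_graph_def)
  have "y = 0" if y: "edge_sum E y = 0" for y
  proof -
    have neg: "y $ v = - y $ u" "u \<noteq> v" if "{u, v} \<in> E" for u v
    proof -
      show "u \<noteq> v" using that s by (auto simp: simple_graph_def)
      have "edge_sum E y $ {u, v} = 0" using y by simp
      then show "y $ v = - y $ u" using that \<open>u \<noteq> v\<close> by (simp add: edge_sum_def)
    qed
    have "(adj_matrix E *v (\<chi> v. y $ v * x $ v)) $ u = - y $ u * (adj_matrix E *v x) $ u" for u
      unfolding adj_matrix_mult sum_distrib_left by (intro sum.cong) (auto simp: neg(1))
    moreover have "adj_matrix E *v x = 0"
      using x(1) span_base by (auto simp: adj_kernel_def)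
    ultimately have "(\<chi> v. y $ v * x $ v) \<in> span {x}"
      by (simp add: x(1) adj_kernel_def vec_eq_iff)
    then obtain c where "(\<chi> v. y $ v * x $ v) = c *\<^sub>R x"
      by (auto simp: span_singleton)
    \<comment> \<open>Every entry of \<open>x\<close> is non-zero and can be cancelled.\<close>
    then have c: "y $ v = c" for v using x(2)[of v] by (auto simp: vec_eq_iff)
    obtain e where "e \<in> E" by (rule nut_graph_edge[OF assms])
    then obtain u v where "{u, v} \<in> E" using simple_graph_edgeE[OF s] by metis
    \<comment> \<open>Along an edge the constant equals its own negative.\<close>
    then have "c = 0" using neg(1)[of u v] c by simp
    then show "y = 0" using c by (simp add: vec_eq_iff)
  qed
  then show ?thesis using linear_edge_sum linear_injective_0 by blast
qed

section \<open>Dimension count\<close>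

theorem theorem1:
  fixes E :: "'v::finite set set"
  assumes "nut_graph E"
  shows "num_edge_orbits E \<ge> num_vertex_orbits E + 1"
proof -
  let ?V = "orbits (aut_group E) UNIV (\<lambda>\<pi>. \<pi>)"
  let ?W = "indicator_vec ` orbits (aut_group E) E (edge_action E)"
  let ?S = "edge_sum E ` indicator_vec ` ?V"
  have s: "simple_graph E" using assms by (simp add: nut_graph_def)
  obtain x where x: "span {x} = adj_kernel E" "x \<noteq> 0" "\<And>v. x $ v \<noteq> 0"
    using assms by (auto simp: nut_graph_def)
  define q where "q = edge_prod E x"
  have inj\<pi>: "inj_on \<pi> e" if "\<pi> \<in> carrier (aut_group E)" for \<pi> and e :: "'v set"
    using that by (meson aut_group_iff bij_is_inj inj_on_subset subset_UNIV)
  interpret group_action "aut_group E" UNIV "\<lambda>\<pi>. \<pi>"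
    by (rule group_action_vertices)
  note inj = inj_edge_sum[OF assms]
  have "independent ?S"
    by (intro linear_independent_injective_image linear_edge_sum inj_on_subset[OF inj]
        independent_indicator_vec pairwise_disjnt_orbits empty_notin_orbits) simp
  moreover have "q \<notin> span ?S"
  proof
    \<comment> \<open>Orthogonality to the generators extends to their span, so \<open>q\<close>
      would be orthogonal to itself, yet it is non-zero on every edge.\<close>
    assume "q \<in> span ?S"
    moreover have "orthogonal q b" if "b \<in> ?S" for b
      using that edge_prod_orthogonal_edge_sum[OF s] x(1) span_base unfolding q_def by blast
    ultimately have "orthogonal q q" by (rule orthogonal_to_span)
    then have "q = 0" by (simp add: orthogonal_self)
    moreover obtain e where "e \<in> E" by (rule nut_graph_edge[OF assms])
    then have "q $ e \<noteq> 0" using x(3) by (simp add: q_def edge_prod_def)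
    ultimately show False by simp
  qed
  ultimately have ind: "independent (insert q ?S)" by (rule independent_insertI[rotated])
  have "?S \<subseteq> span ?W"
  proof clarify
    fix B assume B: "B \<in> ?V"
    have "(\<Sum>v\<in>\<pi> ` e. indicator_vec B $ v) = (\<Sum>v\<in>e. indicator_vec B $ v)"
      if "\<pi> \<in> carrier (aut_group E)" for \<pi> e
      using that indicator_vec_vertex_orbit_invariant[OF B] by (simp add: sum.reindex inj\<pi>)
    then show "edge_sum E (indicator_vec B) \<in> span ?W"
      by (intro invariant_in_span_edge_orbits[OF s]) (auto simp: edge_sum_def)
  qed
  moreover have "q \<in> span ?W"
  proof (rule invariant_in_span_edge_orbits[OF s])
    fix \<pi> e assume \<pi>: "\<pi> \<in> carrier (aut_group E)" and e: "e \<in> E" "\<pi> ` e \<in> E"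
    obtain c where c: "c\<^sup>2 = 1" "\<And>v. x $ \<pi> v = c * x $ v"
      using kernel_vector_automorphism[OF x(1,2) \<pi>] by blast
    \<comment> \<open>With two ends per edge the product picks up exactly
      \<open>c\<^sup>2 = 1\<close>, whatever the sign of \<open>c\<close>.\<close>
    have "card e = 2" using e(1) s by (simp add: simple_graph_def)
    then have "(\<Prod>v\<in>\<pi> ` e. x $ v) = (\<Prod>v\<in>e. x $ v)"
      by (simp add: prod.reindex inj\<pi>[OF \<pi>] c prod.distrib)
    then show "q $ (\<pi> ` e) = q $ e" using e by (simp add: q_def edge_prod_def)
  qed (simp add: q_def edge_prod_def)
  ultimately have "card (insert q ?S) \<le> card ?W"
    using independent_span_bound[OF _ ind] by auto
  \<comment> \<open>Injectivity of both maps keeps one vector per vertex orbit; \<open>q\<close>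
    supplies the additional 1.\<close>
  moreover have "card ?S = card ?V"
    by (simp add: card_image[OF inj_on_subset[OF inj]] card_image[OF inj_on_subset[OF inj_indicator_vec]])
  moreover have "card ?W = num_edge_orbits E"
    by (simp add: num_edge_orbits_def card_image[OF inj_on_subset[OF inj_indicator_vec]])
  moreover have "q \<notin> ?S" using \<open>q \<notin> span ?S\<close> by (meson span_base)
  ultimately show ?thesis by (simp add: num_vertex_orbits_def)
qed

end
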